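(* Let $n, K \ge 1$ be integers, $\mathcal{X} = [0,1]^n$, $\mathcal{Y} = \{1, \dots, K\}$, let $p$ be a probability distribution over $\mathcal{X} \times \mathcal{Y}$ with class conditionals $q_k = p_{X \mid Y = k}$, $k \in \mathcal{Y}$, and let $d$ be a distance (metric) on $\mathcal{X}$. Let $\epsilon, \delta, \gamma \ge 0$. If $p$ is $(\epsilon, \delta, \gamma)$-strongly-localized with respect to $d$, then there exists a classifier $f \colon \mathcal{X} \to \mathcal{Y}$ such that $R_d(f, \epsilon) \le \delta + \gamma$.
   Context: For $S \subseteq \mathcal{X}$ and $r \ge 0$, the $r$-expansion of $S$ in $d$ is $S^{+r} = \{x \in \mathcal{X} : \exists\, \bar x \in S \text{ such that } d(x, \bar x) \le r\}$. Strong localization: $p$ is $(\epsilon, \delta, \gamma)$-strongly-localized with respect to $d$ if there are sets $S_1, \dots, S_K \subseteq \mathcal{X}$ such that for each $k \in \mathcal{Y}$, $q_k(S_k) \ge 1 - \delta$ and $q_k\left( \bigcup_{k' \ne k} S_{k'}^{+2\epsilon} \right) \le \gamma$. Robust risk: with $B_d(x,\epsilon) = \{\bar x \in \mathcal{X} : d(x,\bar x) \le \epsilon\}$, $$R_d(f, \epsilon) = \mathbb{P}_{(x,y) \sim p}\left( \exists\, \bar x \in B_d(x,\epsilon) \text{ such that } f(\bar x) \neq y \right).$$ *)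

theory Defs
  imports "HOL-Analysis.Analysis" "HOL-Probability.Probability"
begin

definition unit_cube :: "(real ^ 'n) set" where
  "unit_cube = {x. \<forall>i. 0 \<le> x $ i \<and> x $ i \<le> 1}"

text \<open>The cube carries the Euclidean Borel sets, whatever metric \<open>d\<close> is put on it later.\<close>

definition cube_space :: "(real ^ 'n) measure" where
  "cube_space = restrict_space borel unit_cube"

text \<open>The labels are \<open>{1..K}\<close>.\<close>

definition data_distribution :: "nat \<Rightarrow> ((real ^ 'n) \<times> nat) measure \<Rightarrow> bool" where
  "data_distribution K p \<longleftrightarrow>
     prob_space p \<and> sets p = sets (cube_space \<Otimes>\<^sub>M count_space {1..K})"

text \<open>
  \<open>q k\<close> is a version of the conditional law of \<open>X\<close> given \<open>Y = k\<close>. If the label \<open>k\<close> has positive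
  probability, then \<open>q k A = p (A \<times> {k}) / p (X \<times> {k})\<close>, so \<open>q k\<close> is uniquely determined; for a
  label of probability zero, any probability measure on the cube is a version.
\<close>

definition class_conditionals ::
    "nat \<Rightarrow> ((real ^ 'n) \<times> nat) measure \<Rightarrow> (nat \<Rightarrow> (real ^ 'n) measure) \<Rightarrow> bool" where
  "class_conditionals K p q \<longleftrightarrow>
     (\<forall>k\<in>{1..K}. prob_space (q k) \<and> sets (q k) = sets (cube_space :: (real ^ 'n) measure) \<and>
        (\<forall>A\<in>sets cube_space.
           emeasure p (A \<times> {k}) = emeasure p (unit_cube \<times> {k}) * emeasure (q k) A))"

definition expansion :: "'a set \<Rightarrow> ('a \<Rightarrow> 'a \<Rightarrow> real) \<Rightarrow> real \<Rightarrow> 'a set \<Rightarrow> 'a set" where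
  "expansion X d r S = {x \<in> X. \<exists>x'\<in>S. d x x' \<le> r}"

text \<open>
  For an arbitrary metric, expansions and the error event below need not be measurable (and
  \<^const>\<open>emeasure\<close> of a non-measurable set is \<open>0\<close>). Their probabilities are therefore
  read as outer measures, which agree with the probability on measurable sets. The sets \<open>S k\<close>
  are required to be measurable.
\<close>

definition strongly_localized ::
    "nat \<Rightarrow> (nat \<Rightarrow> (real ^ 'n) measure) \<Rightarrow> (real ^ 'n \<Rightarrow> real ^ 'n \<Rightarrow> real)
       \<Rightarrow> real \<Rightarrow> real \<Rightarrow> real \<Rightarrow> bool" where
  "strongly_localized K q d \<epsilon> \<delta> \<gamma> \<longleftrightarrow>
     (\<exists>S :: nat \<Rightarrow> (real ^ 'n) set.
        (\<forall>k\<in>{1..K}. S k \<in> sets cube_space) \<and>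
        (\<forall>k\<in>{1..K}.
           emeasure (q k) (S k) \<ge> ennreal (1 - \<delta>) \<and>
           outer_measure_of (q k)
             (\<Union>k'\<in>{1..K} - {k}. expansion unit_cube d (2 * \<epsilon>) (S k')) \<le> ennreal \<gamma>))"

definition robust_risk ::
    "nat \<Rightarrow> ((real ^ 'n) \<times> nat) measure \<Rightarrow> (real ^ 'n \<Rightarrow> real ^ 'n \<Rightarrow> real)
       \<Rightarrow> (real ^ 'n \<Rightarrow> nat) \<Rightarrow> real \<Rightarrow> ennreal" where
  "robust_risk K p d f \<epsilon> =
     outer_measure_of p
       {(x, y). x \<in> unit_cube \<and> y \<in> {1..K} \<and>
          (\<exists>x'\<in>Metric_space.mcball unit_cube d x \<epsilon>. f x' \<noteq> y)}"

end

theory Submission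
  imports Defs
begin

text \<open>
  Send a point of the \<open>\<epsilon>\<close>-expansion of some \<open>S k\<close> to such a label \<open>k\<close>. If \<open>x\<close> lies in
  \<open>S k\<close> but in no \<open>2\<epsilon>\<close>-expansion of another \<open>S k'\<close>, then by the triangle inequality every
  point of the \<open>\<epsilon>\<close>-ball around \<open>x\<close> lies in the \<open>\<epsilon>\<close>-expansion of \<open>S k\<close> and of no other set,
  so the whole ball is labelled \<open>k\<close>. Given the label \<open>k\<close>, an error therefore costs at most
  \<open>\<delta>\<close> (missing \<open>S k\<close>) plus \<open>\<gamma>\<close> (hitting a foreign expansion); average over the labels.
\<close>

lemma space_cube_space [simp]: "space cube_space = unit_cube"
  by (simp add: cube_space_def space_restrict_space)

lemma outer_measure_of_mono_le_emeasure:
  assumes "A \<subseteq> B" "B \<in> sets M"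
  shows "outer_measure_of M A \<le> emeasure M B"
  unfolding outer_measure_of_def using assms by (intro INF_lower) auto

text \<open>The two conjuncts match the definition of the classifier: the first selects its
  \<open>then\<close> branch at \<open>x'\<close>, the second evaluates the choice made there.
  \<open>SOME\<close> is determined because \<open>k\<close> is the only candidate label.\<close>

lemma expansion_classifier_correct:
  fixes S :: "nat \<Rightarrow> 'a set"
  assumes metric: "Metric_space X d"
    and k: "k \<in> I" and S: "\<And>j. j \<in> I \<Longrightarrow> S j \<subseteq> X"
    and x: "x \<in> S k" "x \<notin> (\<Union>j\<in>I - {k}. expansion X d (2 * \<epsilon>) (S j))"
    and x': "x' \<in> Metric_space.mcball X d x \<epsilon>"
  shows "(\<exists>j\<in>I. x' \<in> expansion X d \<epsilon> (S j)) \<and>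
    (SOME j. j \<in> I \<and> x' \<in> expansion X d \<epsilon> (S j)) = k"
proof -
  interpret Metric_space X d by (rule metric)
  have xx: "x \<in> X" "x' \<in> X" "d x x' \<le> \<epsilon>" using x' by auto
  have in_k: "x' \<in> expansion X d \<epsilon> (S k)"
    using xx x(1) by (auto simp: expansion_def commute intro!: bexI[of _ x])
  have "j = k" if j: "j \<in> I" "x' \<in> expansion X d \<epsilon> (S j)" for j
  proof (rule ccontr)
    assume "j \<noteq> k"
    obtain z where z: "z \<in> S j" "d x' z \<le> \<epsilon>"
      using j(2) by (auto simp: expansion_def)
    have "d x z \<le> d x x' + d x' z"
      using triangle xx z S[OF j(1)] by blast
    then have "x \<in> expansion X d (2 * \<epsilon>) (S j)"
      using xx z by (auto simp: expansion_def intro!: bexI[of _ z])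
    with x(2) j(1) \<open>j \<noteq> k\<close> show False by blast
  qed
  then show ?thesis using in_k k by (blast intro: some_equality)
qed

text \<open>Law of total probability: the slices are disjoint, so their union has as measure the
  average of the values \<open>emeasure (q k) (A k)\<close>, weighted by the label probabilities. A
  label of probability zero has weight zero, so the arbitrary choice of its \<open>q k\<close> does
  no harm.\<close>

lemma emeasure_label_slices_le:
  fixes p :: "((real ^ 'n) \<times> nat) measure"
  assumes p: "data_distribution K p" and q: "class_conditionals K p q"
    and A: "\<And>k. k \<in> {1..K} \<Longrightarrow> A k \<in> sets cube_space"
    and le: "\<And>k. k \<in> {1..K} \<Longrightarrow> emeasure (q k) (A k) \<le> c"
  shows "(\<Union>k\<in>{1..K}. A k \<times> {k}) \<in> sets p"
    and "emeasure p (\<Union>k\<in>{1..K}. A k \<times> {k}) \<le> c"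
proof -
  interpret prob_space p using p by (simp add: data_distribution_def)
  have sets_p: "sets p = sets ((cube_space :: (real ^ 'n) measure) \<Otimes>\<^sub>M count_space {1..K})"
    using p by (simp add: data_distribution_def)
  have slice: "B \<times> {k} \<in> sets p" if "B \<in> sets cube_space" "k \<in> {1..K}" for B k
    unfolding sets_p using that by (intro pair_measureI) auto
  have cube: "(unit_cube :: (real ^ 'n) set) \<in> sets cube_space"
    using sets.top[of "cube_space :: (real ^ 'n) measure"] by simp
  show "(\<Union>k\<in>{1..K}. A k \<times> {k}) \<in> sets p"
    using slice A by (intro sets.finite_UN) auto
  have "emeasure p (\<Union>k\<in>{1..K}. A k \<times> {k}) = (\<Sum>k\<in>{1..K}. emeasure p (A k \<times> {k}))"
    using slice A by (intro sum_emeasure[symmetric]) (auto simp: disjoint_family_on_def)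
  also have "\<dots> = (\<Sum>k\<in>{1..K}. emeasure p (unit_cube \<times> {k}) * emeasure (q k) (A k))"
    using q A by (intro sum.cong) (auto simp: class_conditionals_def)
  also have "\<dots> \<le> (\<Sum>k\<in>{1..K}. emeasure p (unit_cube \<times> {k}) * c)"
    using le by (intro sum_mono mult_left_mono) auto
  also have "\<dots> = (\<Sum>k\<in>{1..K}. emeasure p (unit_cube \<times> {k})) * c"
    by (simp add: sum_distrib_right)
  also have "(\<Sum>k\<in>{1..K}. emeasure p (unit_cube \<times> {k})) = emeasure p (\<Union>k\<in>{1..K}. unit_cube \<times> {k})"
    using slice cube by (intro sum_emeasure) (auto simp: disjoint_family_on_def)
  \<comment> \<open>The weights sum to the probability of a single event.\<close>
  also have "\<dots> * c \<le> 1 * c"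
    by (intro mult_right_mono emeasure_le_1) auto
  finally show "emeasure p (\<Union>k\<in>{1..K}. A k \<times> {k}) \<le> c" by simp
qed

text \<open>\<open>U\<close> may be non-measurable, but its outer measure is attained by a
  measurable superset. Replacing \<open>U\<close> by that superset turns the claim into a union
  bound, and the resulting cover is measurable, as the slices over the labels must be.\<close>

lemma measurable_cover_of_error:
  assumes q: "prob_space M" and S: "S \<in> sets M" "emeasure M S \<ge> ennreal (1 - \<delta>)"
    and U: "U \<subseteq> space M" "outer_measure_of M U \<le> ennreal \<gamma>"
    and "\<delta> \<ge> 0" "\<gamma> \<ge> 0"
  shows "\<exists>A\<in>sets M. (space M - S) \<union> U \<subseteq> A \<and> emeasure M A \<le> ennreal (\<delta> + \<gamma>)"
proof -
  interpret prob_space M by (rule q)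
  obtain B where B: "B \<in> sets M" "U \<subseteq> B" "outer_measure_of M U = emeasure M B"
    using outer_measure_of_attain[OF U(1)] by auto
  \<comment> \<open>\<open>ennreal\<close> truncates negative reals to 0, so for \<delta> > 1 the
    bound comes from nonnegativity of \<open>prob S\<close> instead.\<close>
  have "1 - \<delta> \<le> prob S"
    using S(2) by (cases "1 - \<delta> \<ge> 0") (auto simp: emeasure_eq_measure intro: order_trans[OF _ measure_nonneg])
  then have "emeasure M (space M - S) \<le> ennreal \<delta>"
    using S(1) by (simp add: emeasure_eq_measure prob_compl ennreal_leI)
  moreover have "emeasure M ((space M - S) \<union> B) \<le> emeasure M (space M - S) + emeasure M B"
    using S(1) B(1) by (intro emeasure_subadditive) auto
  ultimately have "emeasure M ((space M - S) \<union> B) \<le> ennreal \<delta> + ennreal \<gamma>"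
    using B(3) U(2) by (metis add_mono order_trans)
  then show ?thesis
    using B S(1) \<open>\<delta> \<ge> 0\<close> \<open>\<gamma> \<ge> 0\<close> by (intro bexI[of _ "(space M - S) \<union> B"]) auto
qed

theorem theorem3p2:
  fixes K :: nat
    and p :: "((real ^ 'n) \<times> nat) measure"
    and q :: "nat \<Rightarrow> (real ^ 'n) measure"
    and d :: "real ^ 'n \<Rightarrow> real ^ 'n \<Rightarrow> real"
    and \<epsilon> \<delta> \<gamma> :: real
  assumes "K \<ge> 1"
    and "data_distribution K p"
    and "class_conditionals K p q"
    and "Metric_space unit_cube d"
    and "\<epsilon> \<ge> 0" and "\<delta> \<ge> 0" and "\<gamma> \<ge> 0"
    and "strongly_localized K q d \<epsilon> \<delta> \<gamma>"
  shows "\<exists>f :: real ^ 'n \<Rightarrow> nat.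
           f \<in> unit_cube \<rightarrow> {1..K} \<and> robust_risk K p d f \<epsilon> \<le> ennreal (\<delta> + \<gamma>)"
proof -
  let ?I = "{1..K}"
  let ?exp = "expansion (unit_cube :: (real ^ 'n) set) d"
  obtain S :: "nat \<Rightarrow> (real ^ 'n) set" where
    S: "\<And>k. k \<in> ?I \<Longrightarrow> S k \<in> sets cube_space"
      "\<And>k. k \<in> ?I \<Longrightarrow> emeasure (q k) (S k) \<ge> ennreal (1 - \<delta>)"
      "\<And>k. k \<in> ?I \<Longrightarrow>
        outer_measure_of (q k) (\<Union>j\<in>?I - {k}. ?exp (2 * \<epsilon>) (S j)) \<le> ennreal \<gamma>"
    using assms(8) unfolding strongly_localized_def by blast
  have S_cube: "S k \<subseteq> unit_cube" if "k \<in> ?I" for k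
    using sets.sets_into_space[OF S(1)[OF that]] by simp
  have "\<exists>A\<in>sets cube_space. (unit_cube - S k) \<union> (\<Union>j\<in>?I - {k}. ?exp (2 * \<epsilon>) (S j)) \<subseteq> A \<and>
      emeasure (q k) A \<le> ennreal (\<delta> + \<gamma>)" if k: "k \<in> ?I" for k
  proof -
    have qk: "prob_space (q k)" "sets (q k) = sets cube_space"
      using assms(3) k by (auto simp: class_conditionals_def)
    have sp: "space (q k) = unit_cube" using sets_eq_imp_space_eq[OF qk(2)] by simp
    show ?thesis
      using measurable_cover_of_error[OF qk(1) _ S(2)[OF k] _ S(3)[OF k] assms(6,7)]
      by (auto simp: sp qk(2) S(1)[OF k] expansion_def)
  qed
  then obtain A where A: "\<And>k. k \<in> ?I \<Longrightarrow> A k \<in> sets cube_space"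
      "\<And>k. k \<in> ?I \<Longrightarrow> (unit_cube - S k) \<union> (\<Union>j\<in>?I - {k}. ?exp (2 * \<epsilon>) (S j)) \<subseteq> A k"
      "\<And>k. k \<in> ?I \<Longrightarrow> emeasure (q k) (A k) \<le> ennreal (\<delta> + \<gamma>)"
    by metis
  \<comment> \<open>Off all expansions any label would do; 1 is one since K \<ge> 1. Measurability
    of \<open>f\<close> is no concern, as the risk is an outer measure.\<close>
  define f where "f x = (if \<exists>k\<in>?I. x \<in> ?exp \<epsilon> (S k)
    then SOME k. k \<in> ?I \<and> x \<in> ?exp \<epsilon> (S k) else 1)" for x
  have "f x \<in> ?I" for x
  proof (cases "\<exists>k\<in>?I. x \<in> ?exp \<epsilon> (S k)")
    case True
    then have "\<exists>k. k \<in> ?I \<and> x \<in> ?exp \<epsilon> (S k)" by blast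
    from someI_ex[OF this] True show ?thesis unfolding f_def by simp
  next
    case False
    then show ?thesis using assms(1) unfolding f_def by simp
  qed
  moreover have "robust_risk K p d f \<epsilon> \<le> ennreal (\<delta> + \<gamma>)"
  proof -
    \<comment> \<open>So the error event, measurable or not, lies in the measurable union of the
      slices \<open>A k \<times> {k}\<close>.\<close>
    have "x \<in> A k" if k: "k \<in> ?I" and x: "x \<in> unit_cube"
      and x': "x' \<in> Metric_space.mcball unit_cube d x \<epsilon>" "f x' \<noteq> k" for x x' k
    proof (rule ccontr)
      assume "x \<notin> A k"
      then have "x \<in> S k" "x \<notin> (\<Union>j\<in>?I - {k}. ?exp (2 * \<epsilon>) (S j))"
        using A(2)[OF k] x by blast+
      from expansion_classifier_correct[where I = ?I and S = S, OF assms(4) k S_cube this x'(1)]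
      have "f x' = k" unfolding f_def by simp
      with x'(2) show False by simp
    qed
    then have "{(x, y). x \<in> unit_cube \<and> y \<in> ?I \<and>
        (\<exists>x'\<in>Metric_space.mcball unit_cube d x \<epsilon>. f x' \<noteq> y)} \<subseteq> (\<Union>k\<in>?I. A k \<times> {k})"
      by blast
    then show ?thesis
      unfolding robust_risk_def
      using emeasure_label_slices_le[OF assms(2,3) A(1,3)]
      by (meson outer_measure_of_mono_le_emeasure order_trans)
  qed
  ultimately show ?thesis by blast
qed

end
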